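(* Let $(X,d,\mu)$ be a metric measure space with $\mu$ doubling, let $p(\cdot)\in\mathcal{P}(X)$, and let $\varphi:X\to X$ be a non-singular Borel measurable map. Put $p_\varphi(\cdot)=p(\varphi(\cdot))$. Then the composition operator $T_\varphi:f\mapsto f\circ\varphi$ maps $L^{p(\cdot)}(X)$ into $L^{p_\varphi(\cdot)}(X)$ if and only if the function $x\mapsto u_\varphi(x)^{1/p(x)}$ is essentially bounded, that is, $u_\varphi(\cdot)^{1/p(\cdot)}\in L^\infty(X)$. Moreover (in this case) $$\|T_\varphi\|=\operatorname*{ess\,sup}_{x\in X}\left\{u_\varphi(x)^{\frac{1}{p(x)}}\right\},$$ where $\|T_\varphi\|$ is the operator norm of $T_\varphi:L^{p(\cdot)}(X)\to L^{p_\varphi(\cdot)}(X)$.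
   Context: $(X,d,\mu)$ is a metric space with a Borel regular measure $\mu$ such that every nonempty open set has positive measure and every bounded set has finite measure. $\mathcal{P}(X)$ is the set of Borel measurable functions $p:X\to[1,\infty)$ (not necessarily bounded). $L^{p(\cdot)}(X)$ is the set of measurable $f$ on $X$ such that $\rho(f/\eta)<\infty$ for some $\eta>0$, where $\rho(f)=\int_X|f(x)|^{p(x)}\,d\mu(x)$; it is a Banach space with norm $\|f\|_{p(\cdot)}=\inf\{\eta>0:\rho(f/\eta)\le1\}$. $\mu$ is doubling if there is $C>0$ with $\mu(B(x,2r))\le C\mu(B(x,r))$ for every ball $B(x,r)$. $\varphi$ is non-singular if $\mu(\varphi^{-1}(E))=0$ for every Borel $E$ with $\mu(E)=0$; then $u_\varphi\ge0$ denotes the Radon–Nikodym derivative of $\mu\circ\varphi^{-1}$ with respect to $\mu$, i.e. $\mu(\varphi^{-1}(E))=\int_E u_\varphi\,d\mu$ for all Borel $E\subset X$. *)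

theory Defs
  imports "HOL-Probability.Essential_Supremum"
begin

text \<open>
  The space \<open>X\<close> is a type of class \<open>metric_space\<close>. A Borel regular measure is
  represented by its restriction \<open>M\<close> to the Borel sets, which determines it: every
  set has a Borel hull of the same outer measure. The sigma-algebra of measurable sets
  of the regular measure is then that of \<open>completion M\<close>.
\<close>

definition metric_measure :: "'a::metric_space measure \<Rightarrow> bool" where
  "metric_measure M \<longleftrightarrow>
     sets M = sets borel \<and>
     (\<forall>U. open U \<and> U \<noteq> {} \<longrightarrow> emeasure M U > 0) \<and>
     (\<forall>B\<in>sets borel. bounded B \<longrightarrow> emeasure M B < \<infinity>)"

definition doubling :: "'a::metric_space measure \<Rightarrow> bool" where
  "doubling M \<longleftrightarrow>
     (\<exists>C::real. C > 0 \<and>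
        (\<forall>x r. r > 0 \<longrightarrow> emeasure M (ball x (2 * r)) \<le> ennreal C * emeasure M (ball x r)))"

definition variable_exponents :: "('a::metric_space \<Rightarrow> real) set" where
  "variable_exponents = {p \<in> borel_measurable borel. \<forall>x. 1 \<le> p x}"

definition modular ::
    "'a measure \<Rightarrow> ('a \<Rightarrow> real) \<Rightarrow> ('a \<Rightarrow> 'b::real_normed_vector) \<Rightarrow> ennreal" where
  "modular N p f = (\<integral>\<^sup>+x. ennreal (norm (f x) powr p x) \<partial>N)"

text \<open>Functions are not identified almost everywhere; the quantity \<open>lp_norm\<close> is
  invariant under changes on null sets.\<close>

definition lp_space ::
    "'a measure \<Rightarrow> ('a \<Rightarrow> real) \<Rightarrow> ('a \<Rightarrow> 'b::real_normed_vector) set" where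
  "lp_space N p =
     {f \<in> borel_measurable N. \<exists>\<eta>>0. modular N p (\<lambda>x. f x /\<^sub>R \<eta>) < \<infinity>}"

definition lp_norm ::
    "'a measure \<Rightarrow> ('a \<Rightarrow> real) \<Rightarrow> ('a \<Rightarrow> 'b::real_normed_vector) \<Rightarrow> real" where
  "lp_norm N p f = Inf {\<eta>. \<eta> > 0 \<and> modular N p (\<lambda>x. f x /\<^sub>R \<eta>) \<le> 1}"

text \<open>The operator norm takes values in \<open>[0, \<infinity>]\<close>, so that no boundedness has to be
  presupposed. It is meaningful for operators from \<open>lp_space N p\<close> to \<open>lp_space N q\<close>.\<close>

definition lp_opnorm ::
    "'a measure \<Rightarrow> ('a \<Rightarrow> real) \<Rightarrow> ('a \<Rightarrow> real) \<Rightarrow>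
     (('a \<Rightarrow> 'b::real_normed_vector) \<Rightarrow> ('a \<Rightarrow> 'b)) \<Rightarrow> ennreal" where
  "lp_opnorm N p q T =
     (SUP f \<in> {f \<in> lp_space N p. lp_norm N p f \<le> 1}. ennreal (lp_norm N q (T f)))"

definition comp_op :: "('a \<Rightarrow> 'a) \<Rightarrow> ('a \<Rightarrow> 'b) \<Rightarrow> ('a \<Rightarrow> 'b)" where
  "comp_op \<phi> f = f \<circ> \<phi>"

definition nonsingular :: "'a::metric_space measure \<Rightarrow> ('a \<Rightarrow> 'a) \<Rightarrow> bool" where
  "nonsingular M \<phi> \<longleftrightarrow>
     (\<forall>E\<in>sets borel. emeasure M E = 0 \<longrightarrow> emeasure M (\<phi> -` E) = 0)"

text \<open>The push-forward of \<open>M\<close> need not be sigma-finite, so its Radon--Nikodym derivative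
  may take the value \<open>\<infinity>\<close> on a set of positive measure.\<close>

definition comp_density :: "'a measure \<Rightarrow> ('a \<Rightarrow> 'a) \<Rightarrow> 'a \<Rightarrow> ennreal" where
  "comp_density M \<phi> = RN_deriv M (distr M M \<phi>)"

text \<open>Real powers of extended nonnegative numbers, for positive exponents \<open>a\<close> only.\<close>

definition ennreal_powr :: "ennreal \<Rightarrow> real \<Rightarrow> ennreal" where
  "ennreal_powr u a = (if u = \<infinity> then \<infinity> else ennreal (enn2real u powr a))"

definition essentially_bounded :: "'a measure \<Rightarrow> ('a \<Rightarrow> ennreal) \<Rightarrow> bool" where
  "essentially_bounded M g \<longleftrightarrow>
     g \<in> borel_measurable M \<and> (\<exists>C::real. AE x in M. g x \<le> ennreal C)"

lemma metric_measure_sigma_finite: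
  fixes M :: "'a::metric_space measure"
  assumes "metric_measure M"
  shows "sigma_finite_measure M"
proof
  have sM: "sets M = sets borel" and fin: "\<And>B. B \<in> sets borel \<Longrightarrow> bounded B \<Longrightarrow> emeasure M B < \<infinity>"
    using assms by (auto simp: metric_measure_def)
  define x :: 'a where "x = undefined"
  have "(\<Union>n::nat. ball x (real n)) = space M"
    using sets_eq_imp_space_eq[OF sM] by (auto simp: reals_Archimedean2)
  moreover have "emeasure M (ball x (real n)) \<noteq> \<infinity>" for n
    using fin[of "ball x (real n)"] by simp
  ultimately show "\<exists>A. countable A \<and> A \<subseteq> sets M \<and> \<Union> A = space M \<and> (\<forall>a\<in>A. emeasure M a \<noteq> \<infinity>)"
    by (intro exI[of _ "range (\<lambda>n::nat. ball x (real n))"]) (auto simp: sM)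
qed

lemma emeasure_vimage_eq_comp_density:
  fixes M :: "'a::metric_space measure"
  assumes M: "metric_measure M" and \<phi>: "\<phi> \<in> borel_measurable borel"
    and ns: "nonsingular M \<phi>" and E: "E \<in> sets borel"
  shows "emeasure M (\<phi> -` E) = (\<integral>\<^sup>+x\<in>E. comp_density M \<phi> x \<partial>M)"
proof -
  interpret sigma_finite_measure M
    using M by (rule metric_measure_sigma_finite)
  have sM: "sets M = sets borel"
    using M by (simp add: metric_measure_def)
  have sp: "space M = UNIV"
    using sets_eq_imp_space_eq[OF sM] by simp
  have m: "\<phi> \<in> measurable M M"
    using \<phi> by (simp add: measurable_cong_sets[OF sM sM])
  have "absolutely_continuous M (distr M M \<phi>)"
    unfolding absolutely_continuous_def null_sets_def
    using ns by (auto simp: emeasure_distr[OF m] sp sM nonsingular_def)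
  then have "density M (comp_density M \<phi>) = distr M M \<phi>"
    unfolding comp_density_def by (rule density_RN_deriv) simp
  then have "emeasure (distr M M \<phi>) E = emeasure (density M (comp_density M \<phi>)) E"
    by simp
  then show ?thesis
    using E by (simp add: emeasure_distr[OF m] sp sM emeasure_density comp_density_def)
qed

end

theory Submission
  imports Defs
begin

text \<open>
  Write \<open>u\<close> for the density of the push-forward and \<open>g = u\<^sup>1\<^sup>/\<^sup>p\<close>. The change of
  variables \<open>y = \<phi> x\<close> carries the exponent \<open>p \<circ> \<phi>\<close> back to \<open>p\<close>:
  \<open>\<integral> |f (\<phi> x) / \<eta>| powr p (\<phi> x) = \<integral> u |f / \<eta>| powr p = \<integral> |g f / \<eta>| powr p\<close>.
  So, as far as modulars are concerned, the composition operator is multiplication by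
  \<open>g\<close> on \<open>L\<^sup>p\<close> (lemma \<open>modular_comp_op\<close>), and the theorem is the familiar statement that
  a multiplication operator is bounded exactly when its multiplier is, with the essential
  supremum as its norm.

  If \<open>g \<le> K\<close> almost everywhere then \<open>u \<le> K powr p\<close>, so dilating \<open>\<eta>\<close> by \<open>K\<close> absorbs the
  density (lemma \<open>modular_comp_op_le\<close>).

  Conversely, as \<open>p\<close> may be unbounded, indicator functions are awkward test functions.
  The functions \<open>a\<^sup>1\<^sup>/\<^sup>p\<close> with \<open>a\<close> integrable are better: their modular is \<open>\<integral> a\<close>, and if \<open>a\<close>
  lives where \<open>g > K\<close>, then for \<open>\<eta> \<le> K\<close> the modular of their image divided by \<open>\<eta>\<close> is at
  least \<open>(K / \<eta>) \<integral> a\<close>, because \<open>p \<ge> 1\<close> (lemma \<open>integral_root_comp_ge\<close>). A single such \<open>a\<close>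
  with integral \<open>1\<close> gives the lower bound for the norm. If \<open>g\<close> is unbounded, a sum
  \<open>\<Sum>n. 2\<^sup>-\<^sup>n b\<^sub>n\<close> with \<open>\<integral> b\<^sub>n = 1\<close> and \<open>b\<^sub>n\<close> living where \<open>g > 4\<^sup>n\<close> gives one function whose
  image lies outside the target space (lemma \<open>multiplier_bounded_if_maps_into\<close>).
\<close>

section \<open>Powers of extended nonnegative numbers\<close>

lemma ennreal_powr_inverse_le_iff:
  assumes "0 \<le> K" "0 < q"
  shows "ennreal_powr u (1 / q) \<le> ennreal K \<longleftrightarrow> u \<le> ennreal (K powr q)"
proof (cases u)
  case (real r)
  have "r powr (1 / q) \<le> K \<longleftrightarrow> r \<le> K powr q"
  proof
    assume "r powr (1 / q) \<le> K"
    then have "(r powr (1 / q)) powr q \<le> K powr q"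
      using assms by (intro powr_mono2) auto
    then show "r \<le> K powr q"
      using real assms by (simp add: powr_powr)
  next
    assume "r \<le> K powr q"
    then have "r powr (1 / q) \<le> (K powr q) powr (1 / q)"
      using real assms by (intro powr_mono2) auto
    then show "r powr (1 / q) \<le> K"
      using assms by (simp add: powr_powr)
  qed
  then show ?thesis
    using real assms by (simp add: ennreal_powr_def)
next
  case top
  then show ?thesis
    by (simp add: ennreal_powr_def top_unique)
qed

lemma borel_measurable_ennreal_powr [measurable]:
  assumes [measurable]: "u \<in> borel_measurable M" "a \<in> borel_measurable M"
  shows "(\<lambda>x. ennreal_powr (u x) (a x)) \<in> borel_measurable M"
  unfolding ennreal_powr_def by measurable

section \<open>Variable exponent modulars\<close>

lemma modular_completion: "modular (completion N) p f = modular N p f"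
  unfolding modular_def by (rule nn_integral_completion)

lemma modular_scaleR_antimono:
  assumes "\<And>x. 1 \<le> p x" "0 < \<eta>" "\<eta> \<le> \<eta>'"
  shows "modular N p (\<lambda>x. f x /\<^sub>R \<eta>') \<le> modular N p (\<lambda>x. f x /\<^sub>R \<eta>)"
proof -
  have "norm (f x /\<^sub>R \<eta>') powr p x \<le> norm (f x /\<^sub>R \<eta>) powr p x" for x
    using assms order_trans[OF zero_le_one assms(1)]
    by (intro powr_mono2) (auto simp: field_simps intro!: mult_right_mono)
  then show ?thesis
    unfolding modular_def by (intro nn_integral_mono ennreal_leI)
qed

text \<open>Since \<open>p \<ge> 1\<close>, a finite modular can be pushed below \<open>1\<close> by a dilation, so the set
  whose infimum is the norm is not empty.\<close>

lemma lp_space_modular_le_1: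
  assumes p: "\<And>x. 1 \<le> p x" and [measurable]: "p \<in> borel_measurable N"
    and f: "f \<in> lp_space N p"
  obtains \<eta> where "0 < \<eta>" "modular N p (\<lambda>x. f x /\<^sub>R \<eta>) \<le> 1"
proof -
  obtain \<eta> where \<eta>: "0 < \<eta>" and fin: "modular N p (\<lambda>x. f x /\<^sub>R \<eta>) < \<infinity>"
    using f by (auto simp: lp_space_def)
  have [measurable]: "f \<in> borel_measurable N"
    using f by (auto simp: lp_space_def)
  obtain r where r: "0 \<le> r" "modular N p (\<lambda>x. f x /\<^sub>R \<eta>) = ennreal r"
    using fin by (cases "modular N p (\<lambda>x. f x /\<^sub>R \<eta>)") auto
  define t where "t = r + 1"
  have t: "1 \<le> t" "0 < t" using r by (auto simp: t_def)
  have "modular N p (\<lambda>x. f x /\<^sub>R (t * \<eta>))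
      \<le> (\<integral>\<^sup>+x. ennreal (1 / t) * ennreal (norm (f x /\<^sub>R \<eta>) powr p x) \<partial>N)"
    unfolding modular_def
  proof (rule nn_integral_mono)
    fix x
    have "norm (f x /\<^sub>R (t * \<eta>)) = (norm (f x /\<^sub>R \<eta>)) * (1 / t)"
      using t \<eta> by (simp add: divide_simps)
    then have "norm (f x /\<^sub>R (t * \<eta>)) powr p x = norm (f x /\<^sub>R \<eta>) powr p x * (1 / t) powr p x"
      using t by (simp only: powr_mult)
    also have "\<dots> \<le> norm (f x /\<^sub>R \<eta>) powr p x * (1 / t)"
      using t p[of x] powr_mono'[of 1 "p x" "1 / t"] by (intro mult_left_mono) auto
    finally show "ennreal (norm (f x /\<^sub>R (t * \<eta>)) powr p x)
        \<le> ennreal (1 / t) * ennreal (norm (f x /\<^sub>R \<eta>) powr p x)"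
      using t by (simp add: ennreal_mult'[symmetric] ennreal_leI mult.commute)
  qed
  also have "\<dots> = ennreal (1 / t) * modular N p (\<lambda>x. f x /\<^sub>R \<eta>)"
    unfolding modular_def by (intro nn_integral_cmult) measurable
  also have "\<dots> = ennreal (r / t)"
    using r t by (simp add: ennreal_mult'[symmetric])
  also have "\<dots> \<le> 1"
    using t by (simp add: t_def)
  finally show thesis
    using that[of "t * \<eta>"] t \<eta> by simp
qed

lemma modular_le_1_if_lp_norm_less:
  assumes p: "\<And>x. 1 \<le> p x" and pm: "p \<in> borel_measurable N"
    and f: "f \<in> lp_space N p" and less: "lp_norm N p f < \<eta>"
  shows "modular N p (\<lambda>x. f x /\<^sub>R \<eta>) \<le> 1"
proof -
  let ?S = "{\<eta>. \<eta> > 0 \<and> modular N p (\<lambda>x. f x /\<^sub>R \<eta>) \<le> 1}"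
  have "?S \<noteq> {}"
    using lp_space_modular_le_1[OF p pm f] by blast
  then obtain \<eta>' where "\<eta>' \<in> ?S" "\<eta>' < \<eta>"
    using less cInf_lessD[of ?S \<eta>] unfolding lp_norm_def by blast
  then show ?thesis
    using modular_scaleR_antimono[where p = p and \<eta> = \<eta>' and \<eta>' = \<eta> and N = N and f = f] p
    by (auto intro: order_trans)
qed

lemma lp_norm_le:
  assumes "0 < \<eta>" "modular N p (\<lambda>x. f x /\<^sub>R \<eta>) \<le> 1"
  shows "lp_norm N p f \<le> \<eta>"
  unfolding lp_norm_def using assms
  by (intro cInf_lower) (auto intro!: bdd_belowI[of _ 0])

section \<open>Test functions with prescribed modular\<close>

text \<open>The value \<open>\<infinity>\<close> is sent to \<open>0\<close> by \<open>enn2real\<close>; for a weight of finite integral this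
  happens on a null set only.\<close>

definition variable_root ::
    "('a \<Rightarrow> real) \<Rightarrow> ('a \<Rightarrow> ennreal) \<Rightarrow> ('a \<Rightarrow> 'b::real_normed_algebra_1)" where
  "variable_root p a = (\<lambda>x. of_real (enn2real (a x) powr (1 / p x)))"

lemma borel_measurable_variable_root [measurable]:
  assumes [measurable]: "p \<in> borel_measurable N" "a \<in> borel_measurable N"
  shows "(variable_root p a :: 'a \<Rightarrow> 'b::real_normed_algebra_1) \<in> borel_measurable N"
  unfolding variable_root_def by measurable

lemma norm_variable_root_scaleR_powr:
  fixes a :: "'a \<Rightarrow> ennreal"
  assumes "1 \<le> p x" "0 < \<eta>" "a x \<noteq> \<infinity>"
  shows "ennreal (norm ((variable_root p a :: 'a \<Rightarrow> 'b::real_normed_algebra_1) x /\<^sub>R \<eta>) powr p x)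
           = a x * ennreal (\<eta> powr - p x)"
proof -
  have "norm ((variable_root p a :: 'a \<Rightarrow> 'b) x /\<^sub>R \<eta>) = enn2real (a x) powr (1 / p x) * inverse \<eta>"
    using assms by (simp add: variable_root_def)
  then have "norm ((variable_root p a :: 'a \<Rightarrow> 'b) x /\<^sub>R \<eta>) powr p x
      = (enn2real (a x) powr (1 / p x)) powr p x * inverse \<eta> powr p x"
    using assms by (simp add: powr_mult)
  also have "\<dots> = enn2real (a x) * \<eta> powr - p x"
    using assms by (simp add: powr_powr powr_minus inverse_powr)
  finally show ?thesis
    using assms by (simp add: ennreal_mult' less_top)
qed

text \<open>The weight is cut down from a strictly positive integrable function, which
  exists by sigma-finiteness; this covers sets of infinite measure as well.\<close>

lemma (in sigma_finite_measure) obtain_unit_mass_on: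
  assumes E [measurable]: "E \<in> sets M" and pos: "0 < emeasure M E"
  obtains b :: "'a \<Rightarrow> ennreal" where "b \<in> borel_measurable M" "\<And>x. x \<notin> E \<Longrightarrow> b x = 0"
    "(\<integral>\<^sup>+x. b x \<partial>M) = 1"
proof -
  obtain h :: "'a \<Rightarrow> real" where h [measurable]: "h \<in> borel_measurable M"
    and h0: "\<And>x. h x > 0" and hi: "integrable M h"
    using obtain_positive_integrable_function by metis
  define I where "I = (\<integral>\<^sup>+x. ennreal (h x) * indicator E x \<partial>M)"
  have "I \<le> (\<integral>\<^sup>+x. ennreal (h x) \<partial>M)"
    unfolding I_def by (intro nn_integral_mono) (auto simp: indicator_def)
  also have "\<dots> < \<infinity>"
    using hi h0 by (simp add: nn_integral_eq_integral less_imp_le)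
  finally have fin: "I < \<infinity>" .
  have "I \<noteq> 0"
  proof
    assume "I = 0"
    then have "AE x in M. ennreal (h x) * indicator E x = 0"
      unfolding I_def by (subst (asm) nn_integral_0_iff_AE) auto
    then have "AE x in M. x \<notin> E"
      by eventually_elim (use h0 in \<open>auto simp: indicator_def ennreal_eq_0_iff not_le[symmetric] split: if_splits\<close>)
    then have "emeasure M E = 0"
      using E sets.sets_into_space[OF E] by (subst (asm) AE_iff_measurable[of E]) auto
    then show False using pos by simp
  qed
  show thesis
  proof (rule that[of "\<lambda>x. ennreal (h x) * indicator E x / I"])
    show "(\<integral>\<^sup>+x. ennreal (h x) * indicator E x / I \<partial>M) = 1"
      using fin \<open>I \<noteq> 0\<close>
      by (subst nn_integral_divide) (auto simp: I_def[symmetric] ennreal_divide_self less_top)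
  qed (auto simp: indicator_def)
qed

section \<open>Composition operators as weighted operators\<close>

text \<open>The map is seen only through the density of its push-forward. That such a density
  exists already makes the map non-singular.\<close>

locale density_composition = sigma_finite_measure M
  for M :: "'a measure" +
  fixes p :: "'a \<Rightarrow> real" and \<phi> :: "'a \<Rightarrow> 'a" and u :: "'a \<Rightarrow> ennreal"
  assumes exponent_measurable [measurable]: "p \<in> borel_measurable M"
    and exponent_ge_1: "1 \<le> p x"
    and map_measurable [measurable]: "\<phi> \<in> measurable M M"
    and density_measurable [measurable]: "u \<in> borel_measurable M"
    and density_eq_distr: "density M u = distr M M \<phi>"
begin

definition multiplier :: "'a \<Rightarrow> ennreal" where
  "multiplier x = ennreal_powr (u x) (1 / p x)"

lemma multiplier_measurable [measurable]: "multiplier \<in> borel_measurable M"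
  unfolding multiplier_def by measurable

lemma exponent_pos: "0 < p x"
  using exponent_ge_1[of x] by simp

lemma multiplier_le_iff: "0 \<le> K \<Longrightarrow> multiplier x \<le> ennreal K \<longleftrightarrow> u x \<le> ennreal (K powr p x)"
  unfolding multiplier_def by (intro ennreal_powr_inverse_le_iff exponent_pos)

lemma AE_comp:
  assumes "AE x in M. P x"
  shows "AE x in M. P (\<phi> x)"
proof -
  have "AE x in density M u. P x"
    using assms by (auto simp: AE_density)
  then have "AE x in distr M M \<phi>. P x"
    unfolding density_eq_distr .
  then show ?thesis
    by (rule AE_distrD[OF map_measurable])
qed

lemma map_measurable_completion [measurable]: "\<phi> \<in> measurable (completion M) (completion M)"
proof (rule completion.measurable_completion2)
  show "\<phi> \<in> measurable (completion M) M"
    by (rule measurable_completion) simp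
  show "null_sets M \<subseteq> null_sets (distr (completion M) M \<phi>)"
  proof
    fix N assume N: "N \<in> null_sets M"
    then have "N \<in> null_sets (density M u)"
      by (auto simp: null_sets_density_iff AE_not_in elim: AE_mp[OF AE_not_in])
    then have "\<phi> -` N \<inter> space M \<in> null_sets M"
      unfolding density_eq_distr by (simp add: null_sets_distr_iff)
    then show "N \<in> null_sets (distr (completion M) M \<phi>)"
      using N null_sets_completionI[of _ M]
      by (simp add: null_sets_distr_iff measurable_completion null_setsD2)
  qed
qed

lemma exponent_measurable_completion [measurable]: "p \<in> borel_measurable (completion M)"
  by (rule measurable_completion) simp

text \<open>A function that is measurable for the completion only is exchanged for a
  version measurable for \<open>M\<close> first. The exchange is harmless after composition because \<open>\<phi>\<close> pulls null sets
  back to null sets.\<close>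

lemma nn_integral_comp:
  fixes h :: "'a \<Rightarrow> ennreal"
  assumes "h \<in> borel_measurable (completion M)"
  shows "(\<integral>\<^sup>+x. h (\<phi> x) \<partial>M) = (\<integral>\<^sup>+x. u x * h x \<partial>M)"
proof -
  obtain h' where [measurable]: "h' \<in> borel_measurable M" and ae: "AE x in M. h x = h' x"
    using completion_ex_borel_measurable[OF assms] by blast
  have "(\<integral>\<^sup>+x. h (\<phi> x) \<partial>M) = (\<integral>\<^sup>+x. h' (\<phi> x) \<partial>M)"
    using AE_comp[OF ae] by (rule nn_integral_cong_AE)
  also have "\<dots> = (\<integral>\<^sup>+x. h' x \<partial>distr M M \<phi>)"
    by (simp add: nn_integral_distr)
  also have "\<dots> = (\<integral>\<^sup>+x. u x * h' x \<partial>M)"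
    unfolding density_eq_distr[symmetric] by (simp add: nn_integral_density)
  also have "\<dots> = (\<integral>\<^sup>+x. u x * h x \<partial>M)"
    using ae by (intro nn_integral_cong_AE) auto
  finally show ?thesis .
qed

lemma modular_comp_op:
  fixes f :: "'a \<Rightarrow> 'b::real_normed_vector"
  assumes [measurable]: "f \<in> borel_measurable (completion M)"
  shows "modular M (p \<circ> \<phi>) (\<lambda>x. comp_op \<phi> f x /\<^sub>R \<eta>)
           = (\<integral>\<^sup>+x. u x * ennreal (norm (f x /\<^sub>R \<eta>) powr p x) \<partial>M)"
  unfolding modular_def comp_op_def o_def by (rule nn_integral_comp) measurable

section \<open>Sufficiency and the upper bound\<close>

lemma modular_comp_op_le:
  fixes f :: "'a \<Rightarrow> 'b::real_normed_vector"
  assumes f: "f \<in> borel_measurable (completion M)"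
    and K: "0 < K" "AE x in M. multiplier x \<le> ennreal K" and \<eta>: "0 < \<eta>"
  shows "modular M (p \<circ> \<phi>) (\<lambda>x. comp_op \<phi> f x /\<^sub>R (K * \<eta>)) \<le> modular M p (\<lambda>x. f x /\<^sub>R \<eta>)"
proof -
  have "AE x in M. u x * ennreal (norm (f x /\<^sub>R (K * \<eta>)) powr p x)
      \<le> ennreal (norm (f x /\<^sub>R \<eta>) powr p x)"
    using K(2)
  proof eventually_elim
    case (elim x)
    have "norm (f x /\<^sub>R \<eta>) = K * norm (f x /\<^sub>R (K * \<eta>))"
      using K \<eta> by (simp add: field_simps)
    then have eq: "K powr p x * norm (f x /\<^sub>R (K * \<eta>)) powr p x = norm (f x /\<^sub>R \<eta>) powr p x"
      using K by (simp only: powr_mult)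
    have "u x * ennreal (norm (f x /\<^sub>R (K * \<eta>)) powr p x)
        \<le> ennreal (K powr p x) * ennreal (norm (f x /\<^sub>R (K * \<eta>)) powr p x)"
      using elim K by (intro mult_right_mono) (auto simp: multiplier_le_iff)
    also have "\<dots> = ennreal (norm (f x /\<^sub>R \<eta>) powr p x)"
      by (subst ennreal_mult'[symmetric]) (simp_all only: eq powr_ge_zero)
    finally show ?case .
  qed
  then show ?thesis
    unfolding modular_comp_op[OF f] unfolding modular_def by (rule nn_integral_mono_AE)
qed

lemma comp_op_maps_into:
  fixes f :: "'a \<Rightarrow> 'b::real_normed_vector"
  assumes K: "0 < K" "AE x in M. multiplier x \<le> ennreal K"
    and f: "f \<in> lp_space (completion M) p"
  shows "comp_op \<phi> f \<in> lp_space (completion M) (p \<circ> \<phi>)"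
proof -
  have [measurable]: "f \<in> borel_measurable (completion M)"
    using f by (simp add: lp_space_def)
  obtain \<eta> where \<eta>: "0 < \<eta>" "modular M p (\<lambda>x. f x /\<^sub>R \<eta>) < \<infinity>"
    using f by (auto simp: lp_space_def modular_completion)
  have "modular M (p \<circ> \<phi>) (\<lambda>x. comp_op \<phi> f x /\<^sub>R (K * \<eta>)) < \<infinity>"
    using modular_comp_op_le[OF _ K \<eta>(1), of f] \<eta>(2) by (auto intro: le_less_trans)
  moreover have "comp_op \<phi> f \<in> borel_measurable (completion M)"
    unfolding comp_op_def o_def by measurable
  ultimately show ?thesis
    using K \<eta> unfolding lp_space_def modular_completion by (auto intro!: exI[of _ "K * \<eta>"])
qed

lemma lp_norm_comp_op_le:
  fixes f :: "'a \<Rightarrow> 'b::real_normed_vector"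
  assumes K: "0 < K" "AE x in M. multiplier x \<le> ennreal K"
    and f: "f \<in> lp_space (completion M) p" and norm: "lp_norm (completion M) p f \<le> 1"
  shows "lp_norm (completion M) (p \<circ> \<phi>) (comp_op \<phi> f) \<le> K"
proof -
  have fm: "f \<in> borel_measurable (completion M)"
    using f by (simp add: lp_space_def)
  \<comment> \<open>The norm need not be attained in the defining infimum, whence the slack \<open>\<eta> > 1\<close>.\<close>
  have slack: "lp_norm (completion M) (p \<circ> \<phi>) (comp_op \<phi> f) \<le> K * \<eta>" if "1 < \<eta>" for \<eta>
  proof (rule lp_norm_le)
    have "modular M p (\<lambda>x. f x /\<^sub>R \<eta>) \<le> 1"
      using modular_le_1_if_lp_norm_less[OF exponent_ge_1 _ f, of \<eta>] norm that
      by (simp add: modular_completion)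
    then show "modular (completion M) (p \<circ> \<phi>) (\<lambda>x. comp_op \<phi> f x /\<^sub>R (K * \<eta>)) \<le> 1"
      using modular_comp_op_le[OF fm K, of \<eta>] that by (simp add: modular_completion)
  qed (simp add: \<open>0 < K\<close> less_trans[OF zero_less_one \<open>1 < \<eta>\<close>])
  have "lp_norm (completion M) (p \<circ> \<phi>) (comp_op \<phi> f) / K \<le> \<eta>" if "1 < \<eta>" for \<eta>
    using slack[OF that] K by (simp add: pos_divide_le_eq mult.commute)
  then have "lp_norm (completion M) (p \<circ> \<phi>) (comp_op \<phi> f) / K \<le> 1"
    by (rule dense_ge)
  then show ?thesis
    using K by (simp add: field_simps)
qed

section \<open>Necessity and the lower bound\<close>

lemma modular_variable_root:
  assumes [measurable]: "a \<in> borel_measurable M" and fin: "(\<integral>\<^sup>+x. a x \<partial>M) < \<infinity>"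
  shows "modular M p (variable_root p a :: 'a \<Rightarrow> 'b::real_normed_algebra_1) = (\<integral>\<^sup>+x. a x \<partial>M)"
proof -
  have "AE x in M. a x \<noteq> \<infinity>"
    using fin by (intro nn_integral_noteq_infinite) auto
  then have "AE x in M. ennreal (norm ((variable_root p a :: 'a \<Rightarrow> 'b) x) powr p x) = a x"
  proof eventually_elim
    case (elim x)
    then show ?case
      using norm_variable_root_scaleR_powr[of p x 1 a, where ?'b = 'b] exponent_ge_1[of x] by simp
  qed
  then show ?thesis
    unfolding modular_def by (rule nn_integral_cong_AE)
qed

lemma variable_root_in_lp_space:
  assumes [measurable]: "a \<in> borel_measurable M" and fin: "(\<integral>\<^sup>+x. a x \<partial>M) < \<infinity>"
  shows "(variable_root p a :: 'a \<Rightarrow> 'b::real_normed_algebra_1) \<in> lp_space (completion M) p"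
proof -
  have "(variable_root p a :: 'a \<Rightarrow> 'b) \<in> borel_measurable (completion M)"
    by (rule measurable_completion) measurable
  then show ?thesis
    using modular_variable_root[OF assms, where ?'b = 'b] fin
    by (auto simp: lp_space_def modular_completion intro!: exI[of _ 1])
qed

lemma modular_comp_op_variable_root:
  assumes [measurable]: "a \<in> borel_measurable M" and fin: "(\<integral>\<^sup>+x. a x \<partial>M) < \<infinity>" and "0 < \<eta>"
  shows "modular M (p \<circ> \<phi>)
           (\<lambda>x. comp_op \<phi> (variable_root p a :: 'a \<Rightarrow> 'b::real_normed_algebra_1) x /\<^sub>R \<eta>)
         = (\<integral>\<^sup>+x. u x * (a x * ennreal (\<eta> powr - p x)) \<partial>M)"
proof -
  have m: "(variable_root p a :: 'a \<Rightarrow> 'b) \<in> borel_measurable (completion M)"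
    by (rule measurable_completion) measurable
  have "AE x in M. a x \<noteq> \<infinity>"
    using fin by (intro nn_integral_noteq_infinite) auto
  then have "AE x in M. u x * ennreal (norm ((variable_root p a :: 'a \<Rightarrow> 'b) x /\<^sub>R \<eta>) powr p x)
      = u x * (a x * ennreal (\<eta> powr - p x))"
  proof eventually_elim
    case (elim x)
    then show ?case
      using norm_variable_root_scaleR_powr[of p x \<eta> a, where ?'b = 'b] exponent_ge_1[of x]
        \<open>0 < \<eta>\<close> by simp
  qed
  then show ?thesis
    unfolding modular_comp_op[OF m] by (rule nn_integral_cong_AE)
qed

text \<open>Where \<open>multiplier > K\<close> one has \<open>u \<eta> powr - p \<ge> (K / \<eta>) powr p \<ge> K / \<eta>\<close>; the second
  inequality uses \<open>p \<ge> 1\<close> and \<open>\<eta> \<le> K\<close>. Allowing \<open>a \<ge> b\<close> makes the bound applicable to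
  each summand of a series.\<close>

lemma integral_root_comp_ge:
  assumes [measurable]: "b \<in> borel_measurable M"
    and ba: "\<And>x. b x \<le> a x" and supp: "\<And>x. multiplier x \<le> ennreal K \<Longrightarrow> b x = 0"
    and \<eta>: "0 < \<eta>" "\<eta> \<le> K"
  shows "ennreal (K / \<eta>) * (\<integral>\<^sup>+x. b x \<partial>M) \<le> (\<integral>\<^sup>+x. u x * (a x * ennreal (\<eta> powr - p x)) \<partial>M)"
proof -
  have "ennreal (K / \<eta>) * b x \<le> u x * (a x * ennreal (\<eta> powr - p x))" for x
  proof (cases "multiplier x \<le> ennreal K")
    case True
    then show ?thesis using supp by simp
  next
    case False
    then have u: "ennreal (K powr p x) \<le> u x"
      using \<eta> by (auto simp: multiplier_le_iff)
    have "(K / \<eta>) powr 1 \<le> (K / \<eta>) powr p x"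
      using \<eta> exponent_ge_1 by (intro powr_mono) auto
    then have "K / \<eta> \<le> K powr p x * \<eta> powr - p x"
      using \<eta> by (simp add: powr_divide powr_minus_divide)
    then have "ennreal (K / \<eta>) \<le> ennreal (K powr p x) * ennreal (\<eta> powr - p x)"
      by (simp add: ennreal_mult'[symmetric] ennreal_leI)
    also have "\<dots> \<le> u x * ennreal (\<eta> powr - p x)"
      using u by (rule mult_right_mono) simp
    finally have "ennreal (K / \<eta>) * b x \<le> u x * ennreal (\<eta> powr - p x) * a x"
      using ba by (rule mult_mono) auto
    then show ?thesis
      by (simp add: mult_ac)
  qed
  then have "(\<integral>\<^sup>+x. ennreal (K / \<eta>) * b x \<partial>M) \<le> (\<integral>\<^sup>+x. u x * (a x * ennreal (\<eta> powr - p x)) \<partial>M)"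
    by (rule nn_integral_mono)
  then show ?thesis
    by (simp add: nn_integral_cmult)
qed

lemma obtain_unit_mass_above:
  assumes "\<not> (AE x in M. multiplier x \<le> c)"
  obtains b :: "'a \<Rightarrow> ennreal" where "b \<in> borel_measurable M"
    "\<And>x. multiplier x \<le> c \<Longrightarrow> b x = 0" "(\<integral>\<^sup>+x. b x \<partial>M) = 1"
proof -
  let ?E = "{x \<in> space M. \<not> multiplier x \<le> c}"
  have E: "?E \<in> sets M" by measurable
  moreover have "0 < emeasure M ?E"
    using assms AE_iff_measurable[OF E refl] by (auto simp: zero_less_iff_neq_zero)
  ultimately obtain b :: "'a \<Rightarrow> ennreal" where "b \<in> borel_measurable M"
    "\<And>x. x \<notin> ?E \<Longrightarrow> b x = 0" "(\<integral>\<^sup>+x. b x \<partial>M) = 1"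
    using obtain_unit_mass_on by blast
  then show thesis
    by (intro that[of b]) auto
qed

lemma multiplier_bounded_if_maps_into:
  assumes into: "comp_op \<phi> ` (lp_space (completion M) p :: ('a \<Rightarrow> 'b::real_normed_algebra_1) set)
    \<subseteq> lp_space (completion M) (p \<circ> \<phi>)"
  obtains K :: real where "0 < K" "AE x in M. multiplier x \<le> ennreal K"
proof (rule ccontr)
  assume "\<not> thesis"
  then have "\<not> (AE x in M. multiplier x \<le> ennreal (4 ^ n))" for n
    using that[of "4 ^ n"] by auto
  then have "\<exists>b. b \<in> borel_measurable M \<and> (\<forall>x. multiplier x \<le> ennreal (4 ^ n) \<longrightarrow> b x = 0)
      \<and> (\<integral>\<^sup>+x. b x \<partial>M) = 1" for n
    using obtain_unit_mass_above[of "ennreal (4 ^ n)"] by metis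
  then obtain b :: "nat \<Rightarrow> 'a \<Rightarrow> ennreal" where
    bm [measurable]: "\<And>n. b n \<in> borel_measurable M"
    and b0: "\<And>n x. multiplier x \<le> ennreal (4 ^ n) \<Longrightarrow> b n x = 0"
    and b1: "\<And>n. (\<integral>\<^sup>+x. b n x \<partial>M) = 1"
    by metis
  define a where "a x = (\<Sum>n. ennreal ((1/2) ^ n) * b n x)" for x
  have am [measurable]: "a \<in> borel_measurable M"
    unfolding a_def by measurable
  have "(\<integral>\<^sup>+x. a x \<partial>M) = (\<Sum>n. \<integral>\<^sup>+x. ennreal ((1/2) ^ n) * b n x \<partial>M)"
    unfolding a_def by (rule nn_integral_suminf) measurable
  also have "\<dots> = (\<Sum>n. ennreal ((1/2) ^ n))"
    by (simp add: nn_integral_cmult b1)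
  also have "\<dots> = ennreal (\<Sum>n. (1/2) ^ n)"
    by (rule suminf_ennreal2) (auto intro: summable_geometric)
  finally have fin: "(\<integral>\<^sup>+x. a x \<partial>M) < \<infinity>"
    by simp
  let ?f = "variable_root p a :: 'a \<Rightarrow> 'b"
  have "comp_op \<phi> ?f \<in> lp_space (completion M) (p \<circ> \<phi>)"
    using into variable_root_in_lp_space[OF am fin] by blast
  then obtain \<eta> where \<eta>: "0 < \<eta>"
    and "modular M (p \<circ> \<phi>) (\<lambda>x. comp_op \<phi> ?f x /\<^sub>R \<eta>) < \<infinity>"
    by (auto simp: lp_space_def modular_completion)
  then have "(\<integral>\<^sup>+x. u x * (a x * ennreal (\<eta> powr - p x)) \<partial>M) < \<infinity>"
    by (simp add: modular_comp_op_variable_root[OF am fin])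
  then obtain r where r: "0 \<le> r"
    "(\<integral>\<^sup>+x. u x * (a x * ennreal (\<eta> powr - p x)) \<partial>M) = ennreal r"
    by (cases "\<integral>\<^sup>+x. u x * (a x * ennreal (\<eta> powr - p x)) \<partial>M") auto
  obtain n where n: "max \<eta> (r * \<eta>) < 2 ^ n"
    using real_arch_pow[of 2 "max \<eta> (r * \<eta>)"] by auto
  have pow: "(2::real) ^ n \<le> 4 ^ n"
    by (intro power_mono) auto
  \<comment> \<open>The \<open>n\<close>-th summand alone contributes \<open>2\<^sup>-\<^sup>n (4\<^sup>n / \<eta>) = 2\<^sup>n / \<eta>\<close>.\<close>
  have "ennreal (4 ^ n / \<eta>) * (\<integral>\<^sup>+x. ennreal ((1/2) ^ n) * b n x \<partial>M) \<le> ennreal r"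
    unfolding r(2)[symmetric]
  proof (rule integral_root_comp_ge)
    fix x
    have "(\<Sum>k\<in>{n}. ennreal ((1/2) ^ k) * b k x) \<le> a x"
      unfolding a_def by (intro sum_le_suminf) auto
    then show "ennreal ((1/2) ^ n) * b n x \<le> a x" by simp
  qed (use \<eta> n pow b0 in auto)
  then have "ennreal (4 ^ n / \<eta> * (1/2) ^ n) \<le> ennreal r"
    using \<eta> by (simp add: nn_integral_cmult b1 ennreal_mult'[symmetric])
  then have "4 ^ n / \<eta> * (1/2) ^ n \<le> r"
    using r by simp
  moreover have "(4::real) ^ n = 2 ^ n * 2 ^ n"
    by (simp add: power_mult_distrib[symmetric])
  ultimately have "2 ^ n \<le> r * \<eta>"
    using \<eta> by (simp add: field_simps power_divide)
  then show False
    using n by simp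
qed

text \<open>The test function is the root of a weight of integral \<open>1\<close> that lives where
  \<open>multiplier > K\<close>. If its image divided by some \<open>\<eta> < K\<close> had modular at most \<open>1\<close>, then
  \<open>integral_root_comp_ge\<close> would give \<open>K / \<eta> \<le> 1\<close>.\<close>

lemma lp_norm_comp_op_ge:
  assumes into: "comp_op \<phi> ` (lp_space (completion M) p :: ('a \<Rightarrow> 'b::real_normed_algebra_1) set)
      \<subseteq> lp_space (completion M) (p \<circ> \<phi>)"
    and K: "0 \<le> K" "\<not> (AE x in M. multiplier x \<le> ennreal K)"
  obtains f :: "'a \<Rightarrow> 'b::real_normed_algebra_1" where "f \<in> lp_space (completion M) p"
    "lp_norm (completion M) p f \<le> 1"
    "K \<le> lp_norm (completion M) (p \<circ> \<phi>) (comp_op \<phi> f)"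
proof -
  obtain b :: "'a \<Rightarrow> ennreal" where bm [measurable]: "b \<in> borel_measurable M"
    and b0: "\<And>x. multiplier x \<le> ennreal K \<Longrightarrow> b x = 0" and b1: "(\<integral>\<^sup>+x. b x \<partial>M) = 1"
    using obtain_unit_mass_above[OF K(2)] by blast
  let ?f = "variable_root p b :: 'a \<Rightarrow> 'b"
  have fin: "(\<integral>\<^sup>+x. b x \<partial>M) < \<infinity>" by (simp add: b1)
  have f: "?f \<in> lp_space (completion M) p"
    by (rule variable_root_in_lp_space[OF bm fin])
  have "lp_norm (completion M) p ?f \<le> 1"
    using modular_variable_root[OF bm fin, where ?'b = 'b]
    by (intro lp_norm_le) (auto simp: modular_completion b1)
  moreover have "K \<le> lp_norm (completion M) (p \<circ> \<phi>) (comp_op \<phi> ?f)"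
    unfolding lp_norm_def
  proof (rule cInf_greatest)
    have "comp_op \<phi> ?f \<in> lp_space (completion M) (p \<circ> \<phi>)"
      using into f by blast
    moreover have "p \<circ> \<phi> \<in> borel_measurable (completion M)"
      unfolding o_def by measurable
    moreover have "1 \<le> (p \<circ> \<phi>) x" for x
      using exponent_ge_1 by simp
    ultimately obtain \<eta> where
      "0 < \<eta>" "modular (completion M) (p \<circ> \<phi>) (\<lambda>x. comp_op \<phi> ?f x /\<^sub>R \<eta>) \<le> 1"
      using lp_space_modular_le_1[of "p \<circ> \<phi>"] by blast
    then show "{\<eta>. \<eta> > 0 \<and> modular (completion M) (p \<circ> \<phi>) (\<lambda>x. comp_op \<phi> ?f x /\<^sub>R \<eta>) \<le> 1} \<noteq> {}"
      by (auto simp only: empty_iff mem_Collect_eq set_eq_iff)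
  next
    fix \<eta> assume "\<eta> \<in> {\<eta>. \<eta> > 0 \<and> modular (completion M) (p \<circ> \<phi>) (\<lambda>x. comp_op \<phi> ?f x /\<^sub>R \<eta>) \<le> 1}"
    then have \<eta>: "0 < \<eta>" and le: "(\<integral>\<^sup>+x. u x * (b x * ennreal (\<eta> powr - p x)) \<partial>M) \<le> 1"
      by (auto simp: modular_completion modular_comp_op_variable_root[OF bm fin])
    show "K \<le> \<eta>"
    proof (rule ccontr)
      assume "\<not> K \<le> \<eta>"
      then have "ennreal (K / \<eta>) \<le> (\<integral>\<^sup>+x. u x * (b x * ennreal (\<eta> powr - p x)) \<partial>M)"
        using integral_root_comp_ge[OF bm order_refl b0 \<eta>, of K] by (simp add: b1)
      then have "ennreal (K / \<eta>) \<le> 1"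
        using le by (rule order_trans)
      then show False
        using \<eta> \<open>\<not> K \<le> \<eta>\<close> by (simp add: field_simps)
    qed
  qed
  ultimately show thesis
    using f that by blast
qed

theorem maps_into_iff_essentially_bounded:
  "comp_op \<phi> ` (lp_space (completion M) p :: ('a \<Rightarrow> 'b::real_normed_algebra_1) set)
     \<subseteq> lp_space (completion M) (p \<circ> \<phi>) \<longleftrightarrow> essentially_bounded M multiplier"
proof
  assume "comp_op \<phi> ` (lp_space (completion M) p :: ('a \<Rightarrow> 'b) set)
     \<subseteq> lp_space (completion M) (p \<circ> \<phi>)"
  then show "essentially_bounded M multiplier"
    by (rule multiplier_bounded_if_maps_into) (auto simp: essentially_bounded_def)
next
  assume "essentially_bounded M multiplier"
  then obtain C :: real where C: "AE x in M. multiplier x \<le> ennreal C"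
    by (auto simp: essentially_bounded_def)
  have "AE x in M. multiplier x \<le> ennreal (max C 1)"
    using C by eventually_elim (auto intro: order_trans ennreal_leI)
  then show "comp_op \<phi> ` (lp_space (completion M) p :: ('a \<Rightarrow> 'b) set)
     \<subseteq> lp_space (completion M) (p \<circ> \<phi>)"
    by (intro image_subsetI) (rule comp_op_maps_into, simp_all)
qed

theorem opnorm_eq_esssup:
  assumes into: "comp_op \<phi> ` (lp_space (completion M) p :: ('a \<Rightarrow> 'b::real_normed_algebra_1) set)
     \<subseteq> lp_space (completion M) (p \<circ> \<phi>)"
  shows "lp_opnorm (completion M) p (p \<circ> \<phi>) (comp_op \<phi> :: ('a \<Rightarrow> 'b) \<Rightarrow> _) = esssup M multiplier"
proof (rule antisym)
  show "lp_opnorm (completion M) p (p \<circ> \<phi>) (comp_op \<phi> :: ('a \<Rightarrow> 'b) \<Rightarrow> _) \<le> esssup M multiplier"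
  proof (rule dense_ge)
    fix z assume z: "esssup M multiplier < z"
    show "lp_opnorm (completion M) p (p \<circ> \<phi>) (comp_op \<phi> :: ('a \<Rightarrow> 'b) \<Rightarrow> _) \<le> z"
    proof (cases z)
      case (real K)
      then have "0 < K"
        using le_less_trans[OF zero_le z] by simp
      moreover have "AE x in M. multiplier x \<le> ennreal K"
        using esssup_AE[of multiplier M]
        by eventually_elim (use z real in \<open>simp add: le_less_trans less_imp_le\<close>)
      ultimately show ?thesis
        unfolding lp_opnorm_def real
        by (intro SUP_least ennreal_leI lp_norm_comp_op_le) simp_all
    qed simp
  qed
next
  show "esssup M multiplier \<le> lp_opnorm (completion M) p (p \<circ> \<phi>) (comp_op \<phi> :: ('a \<Rightarrow> 'b) \<Rightarrow> _)"
  proof (rule dense_le)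
    fix z assume z: "z < esssup M multiplier"
    then obtain K where K: "0 \<le> K" "z = ennreal K"
      by (cases z) auto
    have "\<not> (AE x in M. multiplier x \<le> ennreal K)"
      using z K esssup_I[OF multiplier_measurable, of "ennreal K"] leD by metis
    then obtain f :: "'a \<Rightarrow> 'b" where f: "f \<in> lp_space (completion M) p"
      "lp_norm (completion M) p f \<le> 1" "K \<le> lp_norm (completion M) (p \<circ> \<phi>) (comp_op \<phi> f)"
      using lp_norm_comp_op_ge[OF into K(1)] by blast
    then show "z \<le> lp_opnorm (completion M) p (p \<circ> \<phi>) (comp_op \<phi> :: ('a \<Rightarrow> 'b) \<Rightarrow> _)"
      unfolding lp_opnorm_def K by (intro SUP_upper2[of f] ennreal_leI) simp_all
  qed
qed

end

section \<open>Composition operators on metric measure spaces\<close>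

theorem theorem4:
  fixes M :: "'a::metric_space measure"
    and p :: "'a \<Rightarrow> real"
    and \<phi> :: "'a \<Rightarrow> 'a"
    and T :: "('a \<Rightarrow> 'b::{real_normed_field, second_countable_topology}) \<Rightarrow> ('a \<Rightarrow> 'b)"
    and g :: "'a \<Rightarrow> ennreal"
  assumes "metric_measure M" and "doubling M"
    and "p \<in> variable_exponents"
    and "\<phi> \<in> borel_measurable borel" and "nonsingular M \<phi>"
  defines "T \<equiv> comp_op \<phi>"
    and "g \<equiv> (\<lambda>x. ennreal_powr (comp_density M \<phi> x) (1 / p x))"
  shows "(T ` lp_space (completion M) p \<subseteq> lp_space (completion M) (p \<circ> \<phi>)
            \<longleftrightarrow> essentially_bounded M g) \<and>
         (T ` lp_space (completion M) p \<subseteq> lp_space (completion M) (p \<circ> \<phi>)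
            \<longrightarrow> lp_opnorm (completion M) p (p \<circ> \<phi>) T = esssup M g)"
proof -
  have sM: "sets M = sets borel"
    using assms(1) by (simp add: metric_measure_def)
  have sp: "space M = UNIV"
    using sets_eq_imp_space_eq[OF sM] by simp
  interpret sigma_finite_measure M
    using assms(1) by (rule metric_measure_sigma_finite)
  have m: "\<phi> \<in> measurable M M"
    using assms(4) by (simp add: measurable_cong_sets[OF sM sM])
  interpret density_composition M p \<phi> "comp_density M \<phi>"
  proof
    show "p \<in> borel_measurable M" and "1 \<le> p x" for x
      using assms(3) by (auto simp: variable_exponents_def measurable_cong_sets[OF sM refl])
    show "\<phi> \<in> measurable M M" by (rule m)
    show "comp_density M \<phi> \<in> borel_measurable M"
      unfolding comp_density_def by simp
    have "absolutely_continuous M (distr M M \<phi>)"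
      unfolding absolutely_continuous_def null_sets_def
      using assms(5) by (auto simp: emeasure_distr[OF m] sp sM nonsingular_def)
    then show "density M (comp_density M \<phi>) = distr M M \<phi>"
      unfolding comp_density_def by (rule density_RN_deriv) simp
  qed
  have "g = multiplier"
    by (simp add: g_def multiplier_def fun_eq_iff)
  then show ?thesis
    unfolding T_def
    by (simp only: maps_into_iff_essentially_bounded[where ?'b = 'b, symmetric])
      (intro conjI impI refl opnorm_eq_esssup)
qed

end
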